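(* Let $\mathbb{R}\times\mathbb{R}\to\mathbb{R}$ be the trivial line bundle over $\mathbb{R}$, and let $G$ be its generalized subbundle given by $G_x=\mathbb{R}$ (the whole fiber) for $x>0$ and $G_x=\{0\}$ for $x\le 0$. Then $G$ is a smooth generalized subbundle of the trivial line bundle; indeed, it is spanned at every point by the single smooth section $\psi$ (regarded as a function $\mathbb{R}\to\mathbb{R}$) defined by $\psi(x)=e^{-1/x}$ for $x>0$ and $\psi(x)=0$ for $x\le 0$. Moreover, the module $\Gamma(G)$ of smooth global sections of $G$ is not finitely generated as a module over $C^\infty(\mathbb{R})$, and for every interval $J=(-a,a)$ with $a>0$ the module $\Gamma(J;G)$ of smooth sections of $G$ over $J$ is not finitely generated as a module over $C^\infty(J)$.
   Context: A generalized subbundle $G$ of a vector bundle $E\to M$ is an assignment $p\mapsto G_p$ of a linear subspace $G_p\subseteq E_p$ to each point $p\in M$; no continuity in $p$ or constancy of dimension is assumed. A local section of $E$ is a smooth section of $E$ defined on some open subset of $M$; it belongs to $G$ (is a section of $G$) if its value at each point $p$ of its domain lies in $G_p$. $G$ is smooth if for every $p\in M$ there are finitely many local sections $s_1,\dots,s_k$ belonging to $G$, with $p$ in all their domains, such that $G_p=\operatorname{span}\{s_1(p),\dots,s_k(p)\}$. For $U\subseteq M$ open, $\Gamma(U;G)$ is the set of smooth sections of $E$ over $U$ belonging to $G$, a module over the ring $C^\infty(U)$ of smooth real-valued functions on $U$; $\Gamma(G)=\Gamma(M;G)$. Sections of the trivial line bundle over an open set $U\subseteq\mathbb{R}$ are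 identified with smooth functions $U\to\mathbb{R}$. *)

theory Defs
  imports "HOL-Analysis.Analysis" "HOL-Algebra.Module"
begin

text \<open>
  Throughout, bundles are trivial bundles over the real line with fibre a Euclidean space
  \<open>'f\<close> (the trivial line bundle is the case \<open>'f = real\<close>), and a section over \<open>U\<close> is identified
  with a function \<open>real \<Rightarrow> 'f\<close>, of which only the values on \<open>U\<close> are relevant.
\<close>

text \<open>
  Only meant for open \<open>U\<close>: the derivatives are full (not one-sided) derivatives, and on an open
  set they depend only on the restriction of \<open>f\<close> to it.
\<close>

definition smooth_on :: "real set \<Rightarrow> (real \<Rightarrow> 'f::euclidean_space) \<Rightarrow> bool" where
  "smooth_on U f \<longleftrightarrow>
     (\<forall>n. \<forall>x\<in>U. ((\<lambda>g t. vector_derivative g (at t)) ^^ n) f differentiable (at x))"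

text \<open>
  Functions and sections over \<open>U\<close> are represented by their unique extension in \<open>extensional U\<close>,
  so that equality in the carriers below is equality on \<open>U\<close>.
\<close>

definition smooth_functions :: "real set \<Rightarrow> (real \<Rightarrow> real) ring" where
  "smooth_functions U =
    \<lparr>carrier = {f \<in> extensional U. smooth_on U f},
     monoid.mult = (\<lambda>f g. \<lambda>x\<in>U. f x * g x),
     one = (\<lambda>x\<in>U. 1),
     zero = (\<lambda>x\<in>U. 0),
     add = (\<lambda>f g. \<lambda>x\<in>U. f x + g x)\<rparr>"

definition generalized_subbundle :: "(real \<Rightarrow> 'f::euclidean_space set) \<Rightarrow> bool" where
  "generalized_subbundle G \<longleftrightarrow> (\<forall>p. subspace (G p))"

text \<open>
  The fields \<open>mult\<close> and \<open>one\<close> exist only because the library's module record extends the ring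
  record; they play no role for modules.
\<close>

definition sections ::
    "real set \<Rightarrow> (real \<Rightarrow> 'f::euclidean_space set) \<Rightarrow> (real \<Rightarrow> real, real \<Rightarrow> 'f) module" where
  "sections U G =
    \<lparr>carrier = {s \<in> extensional U. smooth_on U s \<and> (\<forall>p\<in>U. s p \<in> G p)},
     monoid.mult = undefined,
     one = undefined,
     zero = (\<lambda>x\<in>U. 0),
     add = (\<lambda>s t. \<lambda>x\<in>U. s x + t x),
     smult = (\<lambda>f s. \<lambda>x\<in>U. f x *\<^sub>R s x)\<rparr>"

definition smooth_generalized_subbundle :: "(real \<Rightarrow> 'f::euclidean_space set) \<Rightarrow> bool" where
  "smooth_generalized_subbundle G \<longleftrightarrow>
     generalized_subbundle G \<and>
     (\<forall>p. \<exists>S :: (real set \<times> (real \<Rightarrow> 'f)) set. finite S \<and>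
        (\<forall>(U, s)\<in>S. open U \<and> p \<in> U \<and> s \<in> carrier (sections U G)) \<and>
        G p = span ((\<lambda>(U, s). s p) ` S))"

definition finitely_generated_module :: "('r, 'b) ring_scheme \<Rightarrow> ('r, 'm, 'c) module_scheme \<Rightarrow> bool"
  where
  "finitely_generated_module R M \<longleftrightarrow>
     (\<exists>S. finite S \<and> S \<subseteq> carrier M \<and>
        (\<forall>m\<in>carrier M. \<exists>c\<in>S \<rightarrow> carrier R. m = (\<Oplus>\<^bsub>M\<^esub>s\<in>S. c s \<odot>\<^bsub>M\<^esub> s)))"


section \<open>Closure properties of smooth functions\<close>

abbreviation (input) vderiv :: "(real \<Rightarrow> 'f::real_normed_vector) \<Rightarrow> real \<Rightarrow> 'f" where
  "vderiv \<equiv> \<lambda>g t. vector_derivative g (at t)"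

definition C_on :: "nat \<Rightarrow> real set \<Rightarrow> (real \<Rightarrow> 'f::euclidean_space) \<Rightarrow> bool" where
  "C_on n U f \<longleftrightarrow> (\<forall>k<n. \<forall>x\<in>U. (vderiv ^^ k) f differentiable (at x))"

lemma smooth_on_C_on: "smooth_on U f \<longleftrightarrow> (\<forall>n. C_on n U f)"
  unfolding smooth_on_def C_on_def by blast

lemma C_on_0: "C_on 0 U f"
  by (simp add: C_on_def)

lemma C_on_Suc: "C_on (Suc n) U f \<longleftrightarrow> (\<forall>x\<in>U. f differentiable (at x)) \<and> C_on n U (vderiv f)"
proof -
  have "(vderiv ^^ Suc k) f = (vderiv ^^ k) (vderiv f)" for k
    by (simp only: funpow_Suc_right o_apply)
  then show ?thesis
    unfolding C_on_def by (auto simp: less_Suc_eq_0_disj simp del: funpow.simps(2))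
qed

lemma C_on_SucD: "C_on (Suc n) U f \<Longrightarrow> C_on n U f"
  by (simp add: C_on_def)

lemma differentiable_cong_open:
  fixes f g :: "real \<Rightarrow> 'f::real_normed_vector"
  assumes "open U" "x \<in> U" "\<And>y. y \<in> U \<Longrightarrow> f y = g y" "f differentiable (at x)"
  shows "g differentiable (at x)"
  using assms unfolding differentiable_def
  by (metis has_derivative_transform_within_open)

lemma vderiv_cong_open:
  fixes f g :: "real \<Rightarrow> 'f::real_normed_vector"
  assumes "open U" "x \<in> U" "\<And>y. y \<in> U \<Longrightarrow> f y = g y"
  shows "vderiv f x = vderiv g x"
proof -
  have "(f has_vector_derivative d) (at x) \<longleftrightarrow> (g has_vector_derivative d) (at x)" for d
    using assms has_vector_derivative_transform_within_open[of f d x U g]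
      has_vector_derivative_transform_within_open[of g d x U f] by auto
  then show ?thesis
    by (simp add: vector_derivative_def)
qed

lemma C_on_cong:
  assumes "open U" "\<And>x. x \<in> U \<Longrightarrow> f x = g x" "C_on n U f"
  shows "C_on n U g"
  using assms(2,3)
proof (induction n arbitrary: f g)
  case 0
  then show ?case by (simp add: C_on_0)
next
  case (Suc n)
  have "C_on n U (vderiv g)"
    by (rule Suc.IH[of "vderiv f"])
       (use Suc.prems vderiv_cong_open[OF assms(1), of _ f g] in \<open>auto simp: C_on_Suc\<close>)
  moreover have "\<forall>x\<in>U. g differentiable (at x)"
    using Suc.prems differentiable_cong_open[OF assms(1), of _ f g] by (auto simp: C_on_Suc)
  ultimately show ?case by (simp add: C_on_Suc)
qed

lemma smooth_on_cong:
  assumes "open U" "\<And>x. x \<in> U \<Longrightarrow> f x = g x"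
  shows "smooth_on U f \<longleftrightarrow> smooth_on U g"
  using C_on_cong[OF assms(1), of f g] C_on_cong[OF assms(1), of g f] assms(2)
  unfolding smooth_on_C_on by auto

lemma C_on_add:
  assumes "open U" "C_on n U f" "C_on n U g"
  shows "C_on n U (\<lambda>x. f x + g x)"
  using assms(2,3)
proof (induction n arbitrary: f g)
  case 0
  then show ?case by (simp add: C_on_0)
next
  case (Suc n)
  have "C_on n U (\<lambda>x. vderiv f x + vderiv g x)"
    using Suc by (auto simp: C_on_Suc)
  then have "C_on n U (vderiv (\<lambda>x. f x + g x))"
    by (rule C_on_cong[OF assms(1), rotated])
       (use Suc.prems in \<open>auto simp: C_on_Suc\<close>)
  then show ?case using Suc.prems by (auto simp: C_on_Suc intro!: differentiable_add)
qed

lemma C_on_scaleR: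
  fixes c :: "real \<Rightarrow> real"
  assumes "open U" "C_on n U c" "C_on n U f"
  shows "C_on n U (\<lambda>x. c x *\<^sub>R f x)"
  using assms(2,3)
proof (induction n arbitrary: c f)
  case 0
  then show ?case by (simp add: C_on_0)
next
  case (Suc n)
  have d: "((\<lambda>x. c x *\<^sub>R f x) has_vector_derivative c x *\<^sub>R vderiv f x + vderiv c x *\<^sub>R f x) (at x)"
    if "x \<in> U" for x
  proof -
    have "(c has_real_derivative vderiv c x) (at x)"
      using Suc.prems that
      by (auto simp: C_on_Suc has_real_derivative_iff_has_vector_derivative vector_derivative_works)
    moreover have "(f has_vector_derivative vderiv f x) (at x)"
      using Suc.prems that by (auto simp: C_on_Suc vector_derivative_works)
    ultimately show ?thesis by (rule has_vector_derivative_scaleR)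
  qed
  have "C_on n U (\<lambda>x. c x *\<^sub>R vderiv f x + vderiv c x *\<^sub>R f x)"
    by (intro C_on_add assms(1) Suc.IH) (use Suc.prems C_on_SucD in \<open>auto simp: C_on_Suc\<close>)
  then have "C_on n U (vderiv (\<lambda>x. c x *\<^sub>R f x))"
    by (rule C_on_cong[OF assms(1), rotated]) (simp add: vector_derivative_at[OF d])
  moreover have "\<forall>x\<in>U. (\<lambda>x. c x *\<^sub>R f x) differentiable (at x)"
    using d by (auto simp: has_vector_derivative_def differentiable_def)
  ultimately show ?case by (simp add: C_on_Suc)
qed

lemma C_on_const: "C_on n U (\<lambda>_. k)"
  by (induction n arbitrary: k) (auto simp: C_on_0 C_on_Suc)

lemma smooth_on_const: "smooth_on U (\<lambda>_. k)"
  by (simp add: smooth_on_C_on C_on_const)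

lemma smooth_on_add:
  "open U \<Longrightarrow> smooth_on U f \<Longrightarrow> smooth_on U g \<Longrightarrow> smooth_on U (\<lambda>x. f x + g x)"
  by (simp add: smooth_on_C_on C_on_add)

lemma smooth_on_scaleR:
  "open U \<Longrightarrow> smooth_on U c \<Longrightarrow> smooth_on U f \<Longrightarrow> smooth_on U (\<lambda>x. c x *\<^sub>R f x)"
  by (simp add: smooth_on_C_on C_on_scaleR)

lemma smooth_on_mult:
  fixes f g :: "real \<Rightarrow> real"
  shows "open U \<Longrightarrow> smooth_on U f \<Longrightarrow> smooth_on U g \<Longrightarrow> smooth_on U (\<lambda>x. f x * g x)"
  using smooth_on_scaleR[of U f g] by simp

lemma smooth_on_minus:
  "open U \<Longrightarrow> smooth_on U f \<Longrightarrow> smooth_on U (\<lambda>x. - f x)"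
  using smooth_on_scaleR[OF _ smooth_on_const[of U "-1::real"], of f] by simp

lemma smooth_on_restrict: "open U \<Longrightarrow> smooth_on U (restrict f U) \<longleftrightarrow> smooth_on U f"
  by (rule smooth_on_cong) auto

lemmas smooth_on_restrict_if = smooth_on_restrict[unfolded restrict_def]


section \<open>The ring of smooth functions and the module of sections\<close>

lemma cring_smooth_functions:
  assumes "open U"
  shows "cring (smooth_functions U)"
proof (rule cringI)
  show "abelian_group (smooth_functions U)"
  proof (rule abelian_groupI)
    fix f assume "f \<in> carrier (smooth_functions U)"
    then show "\<exists>g\<in>carrier (smooth_functions U).
        g \<oplus>\<^bsub>smooth_functions U\<^esub> f = \<zero>\<^bsub>smooth_functions U\<^esub>"
      using assms
      by (intro bexI[of _ "\<lambda>x\<in>U. - f x"])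
         (auto simp: smooth_functions_def smooth_on_restrict smooth_on_minus)
  qed (use assms in \<open>auto simp: smooth_functions_def smooth_on_restrict_if smooth_on_add
         smooth_on_const add_ac extensional_def restrict_def fun_eq_iff\<close>)
  show "Group.comm_monoid (smooth_functions U)"
    by (rule comm_monoidI)
       (use assms in \<open>auto simp: smooth_functions_def smooth_on_restrict_if smooth_on_mult
         smooth_on_const mult_ac extensional_def restrict_def fun_eq_iff\<close>)
qed (auto simp: smooth_functions_def restrict_def fun_eq_iff algebra_simps)

lemma module_sections:
  assumes "open U" "generalized_subbundle G"
  shows "Module.module (smooth_functions U) (sections U G)"
proof (rule Module.moduleI)
  have G: "0 \<in> G p" "a \<in> G p \<Longrightarrow> b \<in> G p \<Longrightarrow> a + b \<in> G p" "a \<in> G p \<Longrightarrow> c *\<^sub>R a \<in> G p"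
    "a \<in> G p \<Longrightarrow> - a \<in> G p" for p a b c
    using assms(2)
    by (auto simp: generalized_subbundle_def subspace_0 subspace_add subspace_scale subspace_neg)
  show "cring (smooth_functions U)"
    using assms(1) by (rule cring_smooth_functions)
  show "abelian_group (sections U G)"
  proof (rule abelian_groupI)
    fix s assume "s \<in> carrier (sections U G)"
    then show "\<exists>t\<in>carrier (sections U G). t \<oplus>\<^bsub>sections U G\<^esub> s = \<zero>\<^bsub>sections U G\<^esub>"
      using assms G
      by (intro bexI[of _ "\<lambda>x\<in>U. - s x"])
         (auto simp: sections_def smooth_on_restrict smooth_on_minus)
  qed (use assms G in \<open>auto simp: sections_def smooth_on_restrict_if smooth_on_add
         smooth_on_const add_ac extensional_def restrict_def fun_eq_iff\<close>)
  show "f \<odot>\<^bsub>sections U G\<^esub> s \<in> carrier (sections U G)"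
    if "f \<in> carrier (smooth_functions U)" "s \<in> carrier (sections U G)" for f s
    using that assms G
    by (auto simp: smooth_functions_def sections_def smooth_on_restrict smooth_on_scaleR)
qed (auto simp: smooth_functions_def sections_def extensional_def restrict_def fun_eq_iff
      algebra_simps)

end

(* If finitely many sections s generated the module over a neighbourhood of 0, then each s / x,
   again a smooth section because s is flat at 0, would be a combination of them with smooth
   coefficients c. So the sum A of the absolute values of the generators would satisfy
   A x <= x * h x * A x with h bounded near 0, which forces A = 0 just to the right of 0. But psi is
   a nonvanishing combination of the generators there. This is Nakayama's lemma with an estimate
   in place of the determinant. *)

theory Submission
  imports Defs
begin

section \<open>Derivatives of smooth functions and division of flat functions by powers of x\<close>

lemma smooth_on_has_real_derivative:
  fixes f :: "real \<Rightarrow> real"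
  assumes "smooth_on U f" "x \<in> U"
  shows "(f has_real_derivative vector_derivative f (at x)) (at x)"
proof -
  have "C_on (Suc 0) U f"
    using assms(1) smooth_on_C_on by blast
  then show ?thesis
    using assms(2) by (auto simp: C_on_Suc has_real_derivative_iff_has_vector_derivative vector_derivative_works)
qed

lemma smooth_on_vderiv:
  assumes "smooth_on U f"
  shows "smooth_on U (\<lambda>x. vector_derivative f (at x))"
  using assms C_on_Suc[of _ U f] unfolding smooth_on_C_on by blast

text \<open>
  The shape \<open>g x / x ^ k\<close> of the derivative covers both uses: \<open>k = 0\<close> when the family is closed
  under differentiation, and \<open>k = 2\<close> for \<open>exp (- 1 / x)\<close>. At \<open>x = 0\<close> the quotient has its limit \<open>0\<close>
  as value because \<open>f 0 = 0\<close> and \<open>y / 0 = 0\<close>.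
\<close>

lemma C_on_flat_divide_power:
  fixes P :: "(real \<Rightarrow> real) \<Rightarrow> bool"
  assumes U: "open U"
    and zero: "\<And>f. P f \<Longrightarrow> f 0 = 0"
    and flat: "\<And>f m. P f \<Longrightarrow> ((\<lambda>x. f x / x ^ m) \<longlongrightarrow> 0) (at 0)"
    and deriv: "\<And>f. P f \<Longrightarrow> \<exists>g k. P g \<and>
        (\<forall>x\<in>U - {0}. (f has_real_derivative g x / x ^ k) (at x))"
    and f: "P f"
  shows "C_on n U (\<lambda>x. f x / x ^ m)"
  using f
proof (induction n arbitrary: f m)
  case 0
  then show ?case by (simp add: C_on_0)
next
  case (Suc n)
  obtain g k where g: "P g" "\<forall>x\<in>U - {0}. (f has_real_derivative g x / x ^ k) (at x)"
    using deriv Suc.prems by blast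
  \<comment> \<open>The quotient rule. Both summands are again members of P over a power of x, up to
    a constant, so the induction hypothesis applies to them; this is why \<open>f\<close> and
    \<open>m\<close> vary in the induction.\<close>
  define d where "d = (\<lambda>x. g x / x ^ (k + m) + (- real m) *\<^sub>R (f x / x ^ Suc m))"
  have d: "((\<lambda>x. f x / x ^ m) has_real_derivative d x) (at x)" if "x \<in> U" for x
  proof (cases "x = 0")
    case True
    \<comment> \<open>This is the difference quotient of \<open>f x / x ^ m\<close> at 0, since that
      function has value 0 there.\<close>
    have "((\<lambda>x. f x / x ^ Suc m) \<longlongrightarrow> 0) (at 0)"
      using flat Suc.prems by blast
    then have "((\<lambda>x. f x / x ^ m) has_real_derivative 0) (at 0)"
      by (simp add: has_field_derivative_iff zero[OF Suc.prems] mult.commute)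
    then show ?thesis
      using True zero[OF Suc.prems] zero[OF g(1)] by (simp add: d_def)
  next
    case False
    have "((\<lambda>x. f x / x ^ m) has_real_derivative
        (g x / x ^ k * x ^ m - f x * (real m * x ^ (m - Suc 0))) / (x ^ m * x ^ m)) (at x)"
      using g(2) that False by (intro DERIV_divide DERIV_pow) auto
    moreover have "(g x / x ^ k * x ^ m - f x * (real m * x ^ (m - Suc 0))) / (x ^ m * x ^ m) = d x"
      \<comment> \<open>For \<open>m = 0\<close> the exponent \<open>m - Suc 0\<close> is truncated
        to 0, but its term carries the factor \<open>real m\<close>.\<close>
      using False by (cases m) (simp_all add: d_def power_add field_simps)
    ultimately show ?thesis by simp
  qed
  have "C_on n U d"
    unfolding d_def by (intro C_on_add C_on_scaleR C_on_const U Suc.IH Suc.prems g)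
  then have "C_on n U (\<lambda>x. vector_derivative (\<lambda>x. f x / x ^ m) (at x))"
    by (rule C_on_cong[OF U, rotated])
       (use d in \<open>metis has_real_derivative_iff_has_vector_derivative vector_derivative_at\<close>)
  then show ?case
    using d by (auto simp: C_on_Suc simp: real_differentiable_def)
qed

section \<open>Smooth functions that vanish for x \<le> 0\<close>

text \<open>The full derivative at \<open>x\<close> agrees with the one within \<open>{..x}\<close>,
  where \<open>f\<close> is zero near \<open>x\<close>; this includes the boundary point 0. The
  class of smooth functions vanishing for x \<le> 0 is thus closed under differentiation.\<close>

lemma vderiv_zero_left:
  fixes f :: "real \<Rightarrow> real"
  assumes "open U" "smooth_on U f" "\<And>x. x \<in> U \<Longrightarrow> x \<le> 0 \<Longrightarrow> f x = 0" "x \<in> U" "x \<le> 0"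
  shows "vector_derivative f (at x) = 0"
proof -
  have "(f has_vector_derivative vector_derivative f (at x)) (at x within {..x})"
    using smooth_on_has_real_derivative[OF assms(2,4)]
    by (simp add: has_real_derivative_iff_has_vector_derivative has_vector_derivative_at_within)
  moreover have "(f has_vector_derivative 0) (at x within {..x})"
  proof -
    obtain e where e: "e > 0" "ball x e \<subseteq> U"
      using assms(1,4) openE by blast
    show ?thesis
    proof (rule has_vector_derivative_transform_within[where d = e and f = "\<lambda>_. 0"])
      show "0 = f y" if "y \<in> {..x}" "dist y x < e" for y
        using that e assms by (auto simp: subset_iff dist_commute)
    qed (use e assms in auto)
  qed
  moreover have "at x within {..x} \<noteq> bot"
    using at_le[of "{..<x}" "{..x}" x] trivial_limit_at_left_real[of x] by (fastforce simp: bot_unique)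
  ultimately show ?thesis
    using vector_derivative_unique_within by blast
qed

text \<open>Induction on \<open>m\<close>, passing to the derivative: for x > 0 the mean value
  theorem trades one power of x for one derivative of \<open>f\<close>.\<close>

lemma smooth_flat_at_zero:
  fixes f :: "real \<Rightarrow> real"
  assumes U: "open U" "0 \<in> U"
    and f: "smooth_on U f" "\<And>x. x \<in> U \<Longrightarrow> x \<le> 0 \<Longrightarrow> f x = 0"
  shows "((\<lambda>x. f x / x ^ m) \<longlongrightarrow> 0) (at 0)"
  using f
proof (induction m arbitrary: f)
  case 0
  have "isCont f 0"
    using smooth_on_has_real_derivative[OF 0(1) U(2)] DERIV_isCont by blast
  then show ?case
    using 0(2)[OF U(2)] by (simp add: isCont_def)
next
  case (Suc m)
  let ?f' = "\<lambda>x. vector_derivative f (at x)"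
  obtain r where r: "r > 0" "ball 0 r \<subseteq> U"
    using U openE by blast
  have IH: "((\<lambda>x. ?f' x / x ^ m) \<longlongrightarrow> 0) (at 0)"
    using Suc.prems by (intro Suc.IH smooth_on_vderiv vderiv_zero_left[OF U(1)]) auto
  show ?case
  proof (rule LIM_I)
    fix e :: real assume "e > 0"
    then obtain d where d: "d > 0" "\<And>x. x \<noteq> 0 \<Longrightarrow> \<bar>x\<bar> < d \<Longrightarrow> \<bar>?f' x / x ^ m\<bar> < e"
      using LIM_D[OF IH] by (metis diff_zero real_norm_def)
    \<comment> \<open>The bound \<open>d\<close> gives the estimate for the derivative at
      intermediate points, and \<open>r\<close> keeps them inside \<open>U\<close>.\<close>
    have "norm (f x / x ^ Suc m - 0) < e" if x: "x \<noteq> 0" "norm (x - 0) < min d r" for x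
    proof (cases "x < 0")
      case True
      then show ?thesis
        using x r Suc.prems(2)[of x] \<open>e > 0\<close> by (auto simp: subset_iff)
    next
      case False
      then have "0 < x" using x by simp
      have in_U: "y \<in> U" if "0 \<le> y" "y \<le> x" for y
        using that x r by (auto simp: subset_iff)
      obtain z where z: "0 < z" "z < x" "f x - f 0 = (x - 0) * ?f' z"
        using MVT2[OF \<open>0 < x\<close>, of f ?f'] smooth_on_has_real_derivative[OF Suc.prems(1) in_U]
        by blast
      have "f x / x ^ Suc m = ?f' z / x ^ m"
        using z(3) Suc.prems(2)[OF U(2)] \<open>0 < x\<close> by simp
      then have "\<bar>f x / x ^ Suc m\<bar> = \<bar>?f' z\<bar> / x ^ m"
        using \<open>0 < x\<close> by simp
      \<comment> \<open>As 0 < z < x, replacing \<open>x\<close> by \<open>z\<close> in the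
        denominator only enlarges the quotient, and the induction hypothesis speaks about
        \<open>z\<close>.\<close>
      also have "\<dots> \<le> \<bar>?f' z\<bar> / z ^ m"
        using z by (intro divide_left_mono power_mono mult_pos_pos zero_less_power) auto
      also have "\<dots> < e"
        using d(2)[of z] z x by simp
      finally show ?thesis by simp
    qed
    then show "\<exists>s>0. \<forall>x. x \<noteq> 0 \<and> norm (x - 0) < s \<longrightarrow> norm (f x / x ^ Suc m - 0) < e"
      using d(1) r(1) by (intro exI[of _ "min d r"]) auto
  qed
qed

text \<open>Supplies the sections \<open>s / x\<close> of the Nakayama argument; the quotient again
  vanishes for x \<le> 0.\<close>

lemma smooth_on_divide_id:
  fixes f :: "real \<Rightarrow> real"
  assumes U: "open U" "0 \<in> U"
    and f: "smooth_on U f" "\<And>x. x \<in> U \<Longrightarrow> x \<le> 0 \<Longrightarrow> f x = 0"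
  shows "smooth_on U (\<lambda>x. f x / x)"
proof -
  let ?P = "\<lambda>f::real \<Rightarrow> real. smooth_on U f \<and> (\<forall>x\<in>U. x \<le> 0 \<longrightarrow> f x = 0)"
  have "C_on n U (\<lambda>x. f x / x ^ 1)" for n
  proof (rule C_on_flat_divide_power[where P = ?P])
    show "\<exists>g k. ?P g \<and> (\<forall>x\<in>U - {0}. (f has_real_derivative g x / x ^ k) (at x))"
      if "?P f" for f :: "real \<Rightarrow> real"
      using that smooth_on_has_real_derivative[of U f] smooth_on_vderiv[of U f]
        vderiv_zero_left[OF U(1), of f]
      by (intro exI[of _ "\<lambda>x. vector_derivative f (at x)"] exI[of _ 0]) auto
  qed (use U f in \<open>auto intro: smooth_flat_at_zero\<close>)
  then show ?thesis
    by (simp add: smooth_on_C_on)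
qed

section \<open>Smoothness of \<psi>\<close>

lemma smooth_on_exp_minus_inverse:
  "smooth_on U (\<lambda>x::real. if x > 0 then exp (- 1 / x) else 0)"
proof -
  define \<psi> where "\<psi> = (\<lambda>x::real. if x > 0 then exp (- 1 / x) else 0)"
  have flat: "((\<lambda>x. \<psi> x / x ^ m) \<longlongrightarrow> 0) (at 0)" for m
  proof -
    \<comment> \<open>Substitute t = 1/x, which tends to infinity: exp t outgrows every power of
      t.\<close>
    have "((\<lambda>x::real. inverse x ^ m / exp (inverse x)) \<longlongrightarrow> 0) (at_right 0)"
      using filterlim_compose[OF tendsto_power_div_exp_0 filterlim_inverse_at_top_right] .
    then have "((\<lambda>x. \<psi> x / x ^ m) \<longlongrightarrow> 0) (at_right 0)"
      by (rule Lim_transform_eventually)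
         (auto simp: eventually_at_filter \<psi>_def exp_minus field_simps)
    moreover have "((\<lambda>x. \<psi> x / x ^ m) \<longlongrightarrow> 0) (at_left 0)"
      by (rule tendsto_eventually) (auto simp: eventually_at_filter \<psi>_def)
    ultimately show ?thesis
      by (simp add: filterlim_split_at)
  qed
  have deriv: "(\<psi> has_real_derivative \<psi> x / x ^ 2) (at x)" if "x \<noteq> 0" for x
  proof (cases "x > 0")
    case True
    have "((\<lambda>x. exp (- 1 / x)) has_real_derivative \<psi> x / x ^ 2) (at x)"
      using True by (auto intro!: derivative_eq_intros simp: \<psi>_def power2_eq_square)
    then show ?thesis
      by (rule has_field_derivative_transform_within_open[where S = "{0<..}"])
         (use True in \<open>auto simp: \<psi>_def\<close>)
  next
    case False
    have "((\<lambda>_. 0) has_real_derivative \<psi> x / x ^ 2) (at x)"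
      using False by (simp add: \<psi>_def)
    then show ?thesis
      by (rule has_field_derivative_transform_within_open[where S = "{..<0}"])
         (use False that in \<open>auto simp: \<psi>_def\<close>)
  qed
  \<comment> \<open>The class P may be the singleton of \<psi>, because the derivative of \<psi> is
    \<psi> itself over \<open>x ^ 2\<close>.\<close>
  have "C_on n UNIV (\<lambda>x. \<psi> x / x ^ 0)" for n
  proof (rule C_on_flat_divide_power[where P = "\<lambda>f. f = \<psi>"])
    show "\<exists>g k. g = \<psi> \<and> (\<forall>x\<in>UNIV - {0}. (f has_real_derivative g x / x ^ k) (at x))"
      if "f = \<psi>" for f
      using that deriv by auto
    show "f 0 = 0" if "f = \<psi>" for f
      using that by (simp add: \<psi>_def)
    show "((\<lambda>x. f x / x ^ m) \<longlongrightarrow> 0) (at 0)" if "f = \<psi>" for f m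
      using that flat by simp
  qed auto
  then show ?thesis
    by (simp add: smooth_on_C_on C_on_def \<psi>_def)
qed

section \<open>Failure of finite generation\<close>

text \<open>Evaluation at \<open>x\<close> respects the module operations. This turns the abstract
  combinations of generators into identities between real numbers.\<close>

lemma finsum_sections_apply:
  assumes "open U" "generalized_subbundle G" "finite S" "S \<subseteq> carrier (sections U G)"
    and "c \<in> S \<rightarrow> carrier (smooth_functions U)" "x \<in> U"
  shows "(\<Oplus>\<^bsub>sections U G\<^esub>s\<in>S. c s \<odot>\<^bsub>sections U G\<^esub> s) x = (\<Sum>s\<in>S. c s x *\<^sub>R s x)"
  using assms(3-5)
proof (induction S rule: finite_induct)
  interpret Module.module "smooth_functions U" "sections U G"
    using assms module_sections by blast
  case empty
  then show ?case
    using assms(6) by (simp add: finsum_empty) (simp add: sections_def)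
next
  interpret Module.module "smooth_functions U" "sections U G"
    using assms module_sections by blast
  case (insert s S)
  have apply_sections: "(f \<odot>\<^bsub>sections U G\<^esub> v) x = f x *\<^sub>R v x"
      "(v \<oplus>\<^bsub>sections U G\<^esub> w) x = v x + w x" for f v w
    using assms(6) by (simp_all add: sections_def)
  have "(\<Oplus>\<^bsub>sections U G\<^esub>t\<in>insert s S. c t \<odot>\<^bsub>sections U G\<^esub> t) =
      c s \<odot>\<^bsub>sections U G\<^esub> s \<oplus>\<^bsub>sections U G\<^esub> (\<Oplus>\<^bsub>sections U G\<^esub>t\<in>S. c t \<odot>\<^bsub>sections U G\<^esub> t)"
    using insert by (intro finsum_insert) (auto intro!: smult_closed)
  moreover have "(\<Oplus>\<^bsub>sections U G\<^esub>t\<in>S. c t \<odot>\<^bsub>sections U G\<^esub> t) x = (\<Sum>t\<in>S. c t x *\<^sub>R t x)"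
    using insert by auto
  ultimately show ?case
    using insert.hyps assms(6) apply_sections by simp
qed

text \<open>The obstruction is local at 0, so one argument for open neighbourhoods of 0 serves both
  the line and the intervals.\<close>

lemma not_finitely_generated_sections_half_line:
  assumes U: "open U" "0 \<in> U"
  shows "\<not> finitely_generated_module (smooth_functions U)
    (sections U (\<lambda>x::real. if x > 0 then UNIV else {0 :: real}))"
proof
  define G where "G = (\<lambda>x::real. if x > 0 then UNIV else {0 :: real})"
  have G: "generalized_subbundle G"
    by (simp add: generalized_subbundle_def G_def subspace_0 subspace_UNIV)
  assume "finitely_generated_module (smooth_functions U)
    (sections U (\<lambda>x::real. if x > 0 then UNIV else {0 :: real}))"
  then obtain S where S: "finite S" "S \<subseteq> carrier (sections U G)"
    and gen: "\<And>m. m \<in> carrier (sections U G) \<Longrightarrow> \<exists>c\<in>S \<rightarrow> carrier (smooth_functions U).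
      m = (\<Oplus>\<^bsub>sections U G\<^esub>s\<in>S. c s \<odot>\<^bsub>sections U G\<^esub> s)"
    unfolding finitely_generated_module_def G_def by blast
  have comb: "\<exists>c\<in>S \<rightarrow> carrier (smooth_functions U). \<forall>x\<in>U. m x = (\<Sum>s\<in>S. c s x * s x)"
    if m: "smooth_on U m" "\<And>x. x \<in> U \<Longrightarrow> x \<le> 0 \<Longrightarrow> m x = 0" for m
  proof -
    have "restrict m U \<in> carrier (sections U G)"
      using m U by (auto simp: sections_def G_def smooth_on_restrict)
    from gen[OF this] obtain c where c: "c \<in> S \<rightarrow> carrier (smooth_functions U)"
      "restrict m U = (\<Oplus>\<^bsub>sections U G\<^esub>s\<in>S. c s \<odot>\<^bsub>sections U G\<^esub> s)"
      by blast
    have "m x = (\<Sum>s\<in>S. c s x * s x)" if "x \<in> U" for x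
      using finsum_sections_apply[OF U(1) G S c(1) that] that c(2)[symmetric] by simp
    then show ?thesis
      using c(1) by blast
  qed
  \<comment> \<open>Expanding every \<open>s / x\<close> in the generators yields a square matrix
    \<open>c s t\<close> of smooth functions.\<close>
  have "\<forall>s\<in>S. \<exists>c. c \<in> S \<rightarrow> carrier (smooth_functions U) \<and>
      (\<forall>x\<in>U. s x / x = (\<Sum>t\<in>S. c t x * t x))"
  proof
    fix s assume "s \<in> S"
    then have s: "smooth_on U s" "\<And>x. x \<in> U \<Longrightarrow> x \<le> 0 \<Longrightarrow> s x = 0"
      using S(2) by (fastforce simp: sections_def G_def)+
    then show "\<exists>c. c \<in> S \<rightarrow> carrier (smooth_functions U) \<and>
        (\<forall>x\<in>U. s x / x = (\<Sum>t\<in>S. c t x * t x))"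
      using comb[OF smooth_on_divide_id[OF U s]] by auto
  qed
  from bchoice[OF this] obtain c where
    c: "\<And>s. s \<in> S \<Longrightarrow> c s \<in> S \<rightarrow> carrier (smooth_functions U)"
    and div: "\<And>s x. s \<in> S \<Longrightarrow> x \<in> U \<Longrightarrow> s x / x = (\<Sum>t\<in>S. c s t x * t x)"
    by blast
  obtain b where b: "\<And>x. x \<in> U \<Longrightarrow>
      (if x > 0 then exp (- 1 / x) else 0) = (\<Sum>s\<in>S. b s x * s x)"
    using comb[OF smooth_on_exp_minus_inverse] by auto
  \<comment> \<open>The sum of the absolute values of all matrix entries is continuous at 0, so
    \<open>x * h x\<close> tends to 0 from the right.\<close>
  define h where "h = (\<lambda>x. \<Sum>s\<in>S. \<Sum>t\<in>S. \<bar>c s t x\<bar>)"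
  have "(c s t \<longlongrightarrow> c s t 0) (at_right 0)" if "s \<in> S" "t \<in> S" for s t
  proof -
    have "smooth_on U (c s t)"
      using c[OF that(1)] that(2) by (auto simp: smooth_functions_def)
    then have "isCont (c s t) 0"
      using smooth_on_has_real_derivative U(2) DERIV_isCont by blast
    then show ?thesis
      using isCont_def filterlim_at_split by blast
  qed
  then have "(h \<longlongrightarrow> h 0) (at_right 0)"
    unfolding h_def by (intro tendsto_sum tendsto_rabs)
  then have "((\<lambda>x. x * h x) \<longlongrightarrow> 0 * h 0) (at_right 0)"
    by (intro tendsto_mult tendsto_ident_at)
  then have "\<forall>\<^sub>F x in at_right 0. x * h x < 1"
    by (rule order_tendstoD) simp
  moreover have "\<forall>\<^sub>F x in at_right 0. x \<in> U"
    using U eventually_at_in_open' eventually_at_split by blast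
  moreover have "\<forall>\<^sub>F x in at_right (0::real). x > 0"
    by (rule eventually_at_right_less)
  ultimately have "\<forall>\<^sub>F x in at_right 0. x * h x < 1 \<and> x \<in> U \<and> x > 0"
    by eventually_elim simp
  \<comment> \<open>A single such point suffices: all generators will vanish at it, while \<psi>
    does not.\<close>
  then obtain x where x: "x * h x < 1" "x \<in> U" "x > 0"
    using eventually_happens' trivial_limit_at_right_real by blast
  define A where "A = (\<Sum>s\<in>S. \<bar>s x\<bar>)"
  have le_A: "\<bar>s x\<bar> \<le> A" if "s \<in> S" for s
    unfolding A_def using S(1) that by (intro member_le_sum) auto
  have "A / x = (\<Sum>s\<in>S. \<bar>\<Sum>t\<in>S. c s t x * t x\<bar>)"
    unfolding A_def sum_divide_distrib using x div by (intro sum.cong) (auto simp flip: div)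
  \<comment> \<open>Triangle inequality, with each generator value bounded by the total
    \<open>A\<close>.\<close>
  also have "\<dots> \<le> (\<Sum>s\<in>S. \<Sum>t\<in>S. \<bar>c s t x\<bar> * A)"
    using le_A by (intro sum_mono order_trans[OF sum_abs]) (auto simp: abs_mult intro!: mult_left_mono)
  also have "\<dots> = h x * A"
    by (simp add: h_def sum_distrib_right)
  finally have "(1 - x * h x) * A \<le> 0"
    using x(3) by (simp add: field_simps)
  then have "A \<le> 0"
    using x(1) by (simp add: mult_le_0_iff)
  then have "s x = 0" if "s \<in> S" for s
    using le_A[OF that] by linarith
  then have "(\<Sum>s\<in>S. b s x * s x) = 0"
    by (simp add: sum.neutral)
  then show False
    using b[OF x(2)] x(3) by simp
qed

section \<open>The subbundle spanned by \<psi>\<close>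

theorem proposition5p3:
  fixes G :: "real \<Rightarrow> real set" and \<psi> :: "real \<Rightarrow> real"
  assumes G_def: "\<And>x. G x = (if x > 0 then UNIV else {0})"
    and psi_def: "\<And>x. \<psi> x = (if x > 0 then exp (- 1 / x) else 0)"
  shows "smooth_generalized_subbundle G
    \<and> \<psi> \<in> carrier (sections UNIV G)
    \<and> (\<forall>x. G x = span {\<psi> x})
    \<and> \<not> finitely_generated_module (smooth_functions UNIV) (sections UNIV G)
    \<and> (\<forall>a>0. \<not> finitely_generated_module (smooth_functions {-a<..<a}) (sections {-a<..<a} G))"
proof -
  have G: "G = (\<lambda>x. if x > 0 then UNIV else {0})"
    using G_def by blast
  have \<psi>: "\<psi> = (\<lambda>x. if x > 0 then exp (- 1 / x) else 0)"
    using psi_def by blast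
  have sect: "\<psi> \<in> carrier (sections UNIV G)"
    using smooth_on_exp_minus_inverse[of UNIV] by (simp add: sections_def G \<psi>)
  have span: "G x = span {\<psi> x}" for x
  proof (cases "x > 0")
    case True
    \<comment> \<open>For x > 0 the value of \<psi> is nonzero, so dividing \<open>y\<close> by it
      gives the coefficient.\<close>
    have "y \<in> span {\<psi> x}" for y
      using True by (auto simp: span_singleton \<psi> intro!: range_eqI[of _ _ "y / exp (- 1 / x)"])
    then show ?thesis
      using True by (auto simp: G)
  qed (simp add: G \<psi>)
  have "smooth_generalized_subbundle G"
    unfolding smooth_generalized_subbundle_def generalized_subbundle_def
    using sect by (auto simp: span intro!: exI[of _ "{(UNIV, \<psi>)}"])
  moreover have "\<not> finitely_generated_module (smooth_functions U) (sections U G)"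
    if "open U" "0 \<in> U" for U
    using not_finitely_generated_sections_half_line[OF that] by (simp add: G)
  ultimately show ?thesis
    using sect span by simp
qed

end
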